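(* Let $\nu_0=\sqrt{1-\sin^2 1}$ and $\nu_1=-\dfrac{\sin 2}{1+\cos 2}$. Let $\beta_1,\beta_2>0$ be real numbers with $\nu_0(\beta_1+\beta_2\nu_1)\geq e$. Let $p$ be an analytic function in $\mathbb{D}$ with $p(0)=1$ and $$1+\beta_1 zp'(z)+\beta_2 z^2p''(z)\prec 1+ze^z.$$ Then $p(z)\prec 1+\sin z$.
   Context: $\mathbb{D}=\{z\in\mathbb{C}:|z|<1\}$. For functions $f,g$ analytic in $\mathbb{D}$, $f\prec g$ ($f$ is subordinate to $g$) means there is an analytic $w:\mathbb{D}\to\mathbb{C}$ with $w(0)=0$ and $|w(z)|\leq|z|$ such that $f(z)=g(w(z))$ for all $z\in\mathbb{D}$. Numerically $\nu_0\approx 0.540302$, $\nu_1\approx -1.55741$. *)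

theory Defs
  imports "HOL-Complex_Analysis.Complex_Analysis"
begin

definition subordinate :: "(complex \<Rightarrow> complex) \<Rightarrow> (complex \<Rightarrow> complex) \<Rightarrow> bool" where
  "subordinate f g \<longleftrightarrow>
     f analytic_on ball 0 1 \<and> g analytic_on ball 0 1 \<and>
     (\<exists>w. w analytic_on ball 0 1 \<and> w 0 = 0 \<and>
          (\<forall>z\<in>ball 0 1. norm (w z) \<le> norm z \<and> f z = g (w z)))"

definition nu0 :: real where
  "nu0 = sqrt (1 - (sin 1)\<^sup>2)"

definition nu1 :: real where
  "nu1 = - (sin 2 / (1 + cos 2))"

end

theory Submission
  imports Defs
begin

text \<open>
  Dividing the differential subordination by \<open>z\<close> gives \<open>\<bar>\<beta>1 p' + \<beta>2 z p''\<bar> \<le> e\<close>. At a point where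
  \<open>\<bar>p'\<bar>\<close> is maximal on a closed disc, \<open>\<bar>p'\<bar>\<close> is nondecreasing in the radial direction, so the term
  \<open>\<beta>2 z p''\<close> cannot cancel \<open>\<beta>1 p'\<close>; hence \<open>\<bar>p'\<bar> \<le> e / \<beta>1 \<le> cos 1\<close> and \<open>\<bar>p z - 1\<bar> \<le> cos 1 * \<bar>z\<bar>\<close>.
  Since \<open>(cos 1)\<^sup>2 < 1/2\<close> and \<open>\<bar>Arcsin u\<bar> \<le> sqrt 2 * \<bar>u\<bar>\<close> when \<open>\<bar>u\<bar>\<^sup>2 < 1/2\<close>, the function
  \<open>Arcsin (p z - 1)\<close> is the required Schwarz function.
\<close>

text \<open>The derivative of \<open>Arcsin\<close> is \<open>1 / cos (Arcsin z)\<close>, and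
  \<open>(cos (Arcsin z))\<^sup>2 = 1 - z\<^sup>2\<close> has modulus at least 1/2 on this disc. The
  mean value inequality from 0 to \<open>u\<close> finishes.\<close>

lemma norm_Arcsin_le:
  assumes "norm u < sqrt (1/2)"
  shows "norm (Arcsin u) \<le> sqrt 2 * norm u"
proof -
  have deriv: "(Arcsin has_field_derivative inverse (cos (Arcsin z))) (at z within ball 0 (sqrt (1/2)))"
    and bound: "norm (inverse (cos (Arcsin z))) \<le> sqrt 2"
    if "z \<in> ball 0 (sqrt (1/2))" for z
  proof -
    have nz: "norm z < sqrt (1/2)" using that by simp
    have "sqrt (1/2) < 1" by simp
    then have "\<bar>Re z\<bar> < 1" using nz abs_Re_le_cmod[of z] by linarith
    then show "(Arcsin has_field_derivative inverse (cos (Arcsin z))) (at z within ball 0 (sqrt (1/2)))"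
      using has_field_derivative_at_within[OF has_field_derivative_Arcsin] by blast
    have "(norm z)\<^sup>2 < 1/2"
      using nz power_strict_mono[of "norm z" "sqrt (1/2)" 2] by simp
    then have "1/2 \<le> norm (1 - z\<^sup>2)"
      using norm_triangle_ineq2[of 1 "z\<^sup>2"] by (simp add: norm_power)
    also have "1 - z\<^sup>2 = (cos (Arcsin z))\<^sup>2"
      by (simp add: cos_squared_eq)
    finally have "sqrt (1/2) \<le> norm (cos (Arcsin z))"
      by (simp add: norm_power real_le_lsqrt)
    then have "inverse (norm (cos (Arcsin z))) \<le> inverse (sqrt (1/2))"
      by (intro le_imp_inverse_le) auto
    then show "norm (inverse (cos (Arcsin z))) \<le> sqrt 2"
      by (simp add: norm_inverse real_sqrt_divide)
  qed
  have "norm (Arcsin u - Arcsin 0) \<le> sqrt 2 * norm (u - 0)"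
    by (rule field_differentiable_bound[OF convex_ball deriv bound]) (use assms in auto)
  then show ?thesis by simp
qed

text \<open>Twice this real inner product is the derivative at \<open>t = 1\<close> of the squared
  norm of \<open>k (t * z)\<close>. Were it negative, that norm would be larger just before
  \<open>t = 1\<close>.\<close>

lemma radial_deriv_nonneg_at_max:
  assumes "(k has_field_derivative d) (at z)"
    and max: "\<And>t. 0 \<le> t \<Longrightarrow> t \<le> 1 \<Longrightarrow> norm (k (of_real t * z)) \<le> norm (k z)"
  shows "0 \<le> k z \<bullet> (z * d)"
proof (rule ccontr)
  assume neg: "\<not> ?thesis"
  define \<phi> where "\<phi> t = k (of_real t * z) \<bullet> k (of_real t * z)" for t :: real
  have vd: "((\<lambda>t. k (of_real t * z)) has_vector_derivative z * d) (at (1::real))"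
  proof -
    have "((\<lambda>t. of_real t * z) has_vector_derivative z) (at (1::real))"
      by (auto intro!: derivative_eq_intros)
    then show ?thesis
      using field_vector_diff_chain_at[of "\<lambda>t. of_real t * z" z 1 k d] assms(1)
      by (simp add: o_def)
  qed
  have "(\<phi> has_derivative (\<lambda>h. k z \<bullet> (h *\<^sub>R (z * d)) + (h *\<^sub>R (z * d)) \<bullet> k z)) (at 1)"
    using has_derivative_inner[OF vd[unfolded has_vector_derivative_def]
        vd[unfolded has_vector_derivative_def]]
    unfolding \<phi>_def by simp
  then have "(\<phi> has_real_derivative 2 * (k z \<bullet> (z * d))) (at 1)"
    unfolding has_field_derivative_def
    by (rule has_derivative_eq_rhs) (auto simp: inner_commute algebra_simps)
  then obtain \<delta> where \<delta>: "0 < \<delta>" "\<And>h. 0 < h \<Longrightarrow> h < \<delta> \<Longrightarrow> \<phi> 1 < \<phi> (1 - h)"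
    using DERIV_neg_dec_left[of \<phi> _ 1] neg by force
  define h where "h = min (\<delta> / 2) 1"
  have h: "0 < h" "h < \<delta>" "h \<le> 1" using \<delta>(1) by (auto simp: h_def)
  have "norm (k (of_real (1 - h) * z)) \<le> norm (k z)"
    using h by (intro max) auto
  then have "\<phi> (1 - h) \<le> \<phi> 1"
    unfolding \<phi>_def by (simp add: dot_square_norm power_mono)
  with \<delta>(2)[of h] h show False by simp
qed

lemma norm_le_of_first_order_bound:
  fixes a b :: real
  assumes "a > 0" "b \<ge> 0" and hol: "k holomorphic_on ball 0 1"
    and bound: "\<And>z. z \<in> ball 0 1 \<Longrightarrow> norm (of_real a * k z + of_real b * z * deriv k z) \<le> M"
    and z: "z \<in> ball 0 1"
  shows "a * norm (k z) \<le> M"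
proof -
  have sub: "cball 0 (norm z) \<subseteq> ball (0::complex) 1" using z by auto
  have "continuous_on (cball 0 (norm z)) (\<lambda>x. norm (k x))"
    using hol sub holomorphic_on_imp_continuous_on continuous_on_subset continuous_on_norm by blast
  \<comment> \<open>The maximum point \<open>y\<close> may lie on the boundary circle; the segment
    from 0 to \<open>y\<close> stays in the closed disc, which is all that the radial lemma
    compares.\<close>
  then obtain y where y: "y \<in> cball 0 (norm z)"
    and max: "\<And>x. x \<in> cball 0 (norm z) \<Longrightarrow> norm (k x) \<le> norm (k y)"
    using continuous_attains_sup[of "cball 0 (norm z)" "\<lambda>x. norm (k x)"] by force
  have yb: "y \<in> ball 0 1" using y sub by blast
  have "0 \<le> k y \<bullet> (y * deriv k y)"
  proof (rule radial_deriv_nonneg_at_max)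
    show "(k has_field_derivative deriv k y) (at y)"
      using hol yb by (simp add: holomorphic_derivI)
    fix t :: real assume "0 \<le> t" "t \<le> 1"
    then have "norm (of_real t * y) \<le> norm y"
      by (simp add: norm_mult mult_left_le_one_le)
    then show "norm (k (of_real t * y)) \<le> norm (k y)"
      using y by (intro max) auto
  qed
  \<comment> \<open>Pairing the bounded expression with \<open>k y\<close> makes the
    \<open>b\<close> term nonnegative; Cauchy-Schwarz then bounds the pairing by
    \<open>norm (k y) * M\<close>.\<close>
  then have "a * (norm (k y))\<^sup>2 \<le> a * (norm (k y))\<^sup>2 + b * (k y \<bullet> (y * deriv k y))"
    using \<open>b \<ge> 0\<close> by simp
  also have "\<dots> = k y \<bullet> (a *\<^sub>R k y + b *\<^sub>R (y * deriv k y))"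
    by (simp add: inner_add_right dot_square_norm)
  also have "\<dots> = k y \<bullet> (of_real a * k y + of_real b * y * deriv k y)"
    by (simp add: scaleR_conv_of_real mult.assoc)
  also have "\<dots> \<le> norm (k y) * M"
    using norm_cauchy_schwarz bound[OF yb] mult_left_mono norm_ge_zero order_trans by meson
  finally have "norm (k y) * (a * norm (k y)) \<le> norm (k y) * M"
    by (simp add: power2_eq_square algebra_simps)
  moreover have "0 \<le> M" using bound[OF z] norm_ge_zero order_trans by blast
  ultimately have "a * norm (k y) \<le> M"
    by (cases "k y = 0") auto
  moreover have "a * norm (k z) \<le> a * norm (k y)"
    using max[of z] \<open>a > 0\<close> by (intro mult_left_mono) auto
  ultimately show ?thesis by linarith
qed

text \<open>Cancels the factor \<open>z\<close> away from the origin; the bound at 0 follows by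
  passing to the limit.\<close>

lemma norm_le_of_norm_mult_le:
  fixes F :: "complex \<Rightarrow> complex"
  assumes cont: "continuous_on (ball 0 1) F"
    and le: "\<And>z. z \<in> ball 0 1 \<Longrightarrow> norm (z * F z) \<le> M * norm z"
    and z: "z \<in> ball 0 1"
  shows "norm (F z) \<le> M"
proof -
  have nz: "norm (F x) \<le> M" if "x \<in> ball 0 1" "x \<noteq> 0" for x
    using le[OF that(1)] that(2) by (simp add: norm_mult mult.commute)
  show ?thesis
  proof (cases "z = 0")
    case True
    have "(F \<longlongrightarrow> F 0) (at 0)"
      using cont by (simp add: continuous_on_eq_continuous_at isCont_def)
    moreover have "\<forall>\<^sub>F x in at 0. norm (F x) \<le> M"
      using nz eventually_at_ball'[of 1 0 UNIV] by (auto elim: eventually_mono)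
    ultimately show ?thesis using True Lim_norm_ubound[of "at 0" F] by simp
  qed (use nz z in auto)
qed

text \<open>Here \<open>nu0\<close> is \<open>cos 1\<close>, so the double-angle formula reduces the
  claim to \<open>cos 2 < 0\<close>.\<close>

lemma nu0_sq_less: "nu0\<^sup>2 < 1/2"
proof -
  have "nu0\<^sup>2 = (cos 1)\<^sup>2"
    by (simp add: nu0_def cos_squared_eq[symmetric])
  also have "\<dots> = (1 + cos 2) / 2"
    using cos_double_cos[of "1::real"] by simp
  finally show ?thesis using cos_two_less_zero by simp
qed

lemma nu0_nonneg: "nu0 \<ge> 0"
  by (simp add: nu0_def cos_squared_eq[symmetric])

lemma nu1_nonpos: "nu1 \<le> 0"
proof -
  have "0 < sin (2::real)" using pi_gt3 by (intro sin_gt_zero) auto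
  \<comment> \<open>A weak inequality suffices, since division by zero yields 0.\<close>
  moreover have "0 \<le> 1 + cos (2::real)" using cos_ge_minus_one[of 2] by linarith
  ultimately show ?thesis by (simp add: nu1_def)
qed

theorem theorem2p6:
  fixes \<beta>1 \<beta>2 :: real and p :: "complex \<Rightarrow> complex"
  assumes "\<beta>1 > 0" and "\<beta>2 > 0"
    and "nu0 * (\<beta>1 + \<beta>2 * nu1) \<ge> exp 1"
    and "p analytic_on ball 0 1" and "p 0 = 1"
    and "subordinate
           (\<lambda>z. 1 + of_real \<beta>1 * z * deriv p z + of_real \<beta>2 * z\<^sup>2 * deriv (deriv p) z)
           (\<lambda>z. 1 + z * exp z)"
  shows "subordinate p (\<lambda>z. 1 + sin z)"
proof -
  have hol: "p holomorphic_on ball 0 1"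
    using assms(4) by (simp add: analytic_on_open)
  then have hol': "deriv p holomorphic_on ball 0 1"
    and hol'': "deriv (deriv p) holomorphic_on ball 0 1"
    by (auto intro!: holomorphic_deriv)
  define F where "F z = of_real \<beta>1 * deriv p z + of_real \<beta>2 * z * deriv (deriv p) z" for z
  obtain w where w: "\<And>z. z \<in> ball 0 1 \<Longrightarrow> norm (w z) \<le> norm z"
      "\<And>z. z \<in> ball 0 1 \<Longrightarrow> 1 + of_real \<beta>1 * z * deriv p z + of_real \<beta>2 * z\<^sup>2 * deriv (deriv p) z
         = 1 + w z * exp (w z)"
    using assms(6) unfolding subordinate_def by blast
  \<comment> \<open>The subordination reads \<open>z * F z = w z * exp (w z)\<close>, and
    \<open>norm (w z) \<le> norm z < 1\<close> bounds the exponential factor by e.\<close>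
  have F_le: "norm (F z) \<le> exp 1" if "z \<in> ball 0 1" for z
  proof (rule norm_le_of_norm_mult_le[OF _ _ that])
    show "continuous_on (ball 0 1) F"
      unfolding F_def
      by (intro holomorphic_on_imp_continuous_on holomorphic_intros hol' hol'')
    fix x :: complex assume x: "x \<in> ball 0 1"
    have "norm (exp (w x)) \<le> exp (norm (w x))" by (rule norm_exp)
    also have "\<dots> \<le> exp 1" using w(1)[OF x] x by simp
    finally have "norm (w x * exp (w x)) \<le> norm x * exp 1"
      using w(1)[OF x] by (simp only: norm_mult mult_mono norm_ge_zero)
    moreover have "x * F x = w x * exp (w x)"
      using w(2)[OF x] by (simp add: F_def power2_eq_square algebra_simps)
    ultimately show "norm (x * F x) \<le> exp 1 * norm x" by (simp add: mult.commute)
  qed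
  \<comment> \<open>The summand \<open>nu0 * \<beta>2 * nu1\<close> is nonpositive, so dropping it
    only enlarges the left side of the numerical hypothesis.\<close>
  have "exp 1 \<le> nu0 * \<beta>1"
    using assms(3) mult_nonneg_nonpos[OF nu0_nonneg mult_nonneg_nonpos[OF less_imp_le[OF \<open>\<beta>2 > 0\<close>] nu1_nonpos]]
    by (simp add: distrib_left)
  have deriv_le: "norm (deriv p z) \<le> nu0" if "z \<in> ball 0 1" for z
  proof -
    have "\<beta>1 * norm (deriv p z) \<le> exp 1"
      using norm_le_of_first_order_bound[OF \<open>\<beta>1 > 0\<close> less_imp_le[OF \<open>\<beta>2 > 0\<close>] hol' _ that] F_le
      by (simp add: F_def)
    also note \<open>exp 1 \<le> nu0 * \<beta>1\<close>
    finally show ?thesis using \<open>\<beta>1 > 0\<close> by (simp add: mult.commute)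
  qed
  have p_le: "norm (p z - 1) \<le> nu0 * norm z" if "z \<in> ball 0 1" for z
  proof -
    have "norm (p z - p 0) \<le> nu0 * norm (z - 0)"
    proof (rule field_differentiable_bound[OF convex_ball _ deriv_le])
      show "(p has_field_derivative deriv p x) (at x within ball 0 1)" if "x \<in> ball 0 1" for x
        using hol that by (simp add: holomorphic_derivI)
    qed (use that in auto)
    then show ?thesis using assms(5) by simp
  qed
  \<comment> \<open>This threshold keeps \<open>p z - 1\<close> in the disc of the
    \<open>Arcsin\<close> estimate and offsets its constant \<open>sqrt 2\<close>.\<close>
  have nu0_less: "nu0 < sqrt (1/2)"
    using nu0_sq_less real_less_rsqrt by blast
  have p_less: "norm (p z - 1) < sqrt (1/2)" if "z \<in> ball 0 1" for z
  proof -
    have "nu0 * norm z \<le> nu0" using that nu0_nonneg by (simp add: mult_left_le)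
    then show ?thesis using p_le[OF that] nu0_less by linarith
  qed
  have Arcsin_le: "norm (Arcsin (p z - 1)) \<le> norm z" if "z \<in> ball 0 1" for z
  proof -
    have "sqrt 2 * nu0 \<le> sqrt 2 * sqrt (1/2)"
      using nu0_less by (intro mult_left_mono) auto
    also have "\<dots> = 1" by (simp flip: real_sqrt_mult)
    finally have c: "sqrt 2 * nu0 \<le> 1" .
    have "norm (Arcsin (p z - 1)) \<le> sqrt 2 * norm (p z - 1)"
      by (rule norm_Arcsin_le[OF p_less[OF that]])
    also have "\<dots> \<le> (sqrt 2 * nu0) * norm z"
      using p_le[OF that] by (simp add: mult.assoc)
    also have "\<dots> \<le> norm z" using c by (simp add: mult_left_le_one_le nu0_nonneg)
    finally show ?thesis .
  qed
  have "(\<lambda>z. Arcsin (p z - 1)) holomorphic_on ball 0 1"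
  \<comment> \<open>The strip \<open>\<bar>Re u\<bar> < 1\<close> avoids the branch cuts of
    \<open>Arcsin\<close>.\<close>
  proof (intro holomorphic_on_compose[of "\<lambda>z. p z - 1" _ Arcsin, unfolded o_def]
      holomorphic_intros hol holomorphic_on_Arcsin)
    fix u assume "u \<in> (\<lambda>z. p z - 1) ` ball 0 1"
    then have "norm u < sqrt (1/2)" using p_less by auto
    moreover have "sqrt (1/2) < (1::real)" by simp
    ultimately show "\<bar>Re u\<bar> < 1" using abs_Re_le_cmod[of u] by linarith
  qed
  then have "(\<lambda>z. Arcsin (p z - 1)) analytic_on ball 0 1"
    by (simp add: analytic_on_open)
  moreover have "(\<lambda>z::complex. 1 + sin z) analytic_on ball 0 1"
    by (intro analytic_intros)
  \<comment> \<open>The witness works because \<open>sin (Arcsin u) = u\<close>, and it vanishes at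
    0 because \<open>p 0 = 1\<close>.\<close>
  ultimately show ?thesis
    unfolding subordinate_def using assms(4,5) Arcsin_le
    by (intro conjI exI[of _ "\<lambda>z. Arcsin (p z - 1)"]) auto
qed

end
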